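(* Let $\mathcal N=\mathbb M_d$, let $\Phi:\mathbb M_d\to\mathbb M_d$ be completely positive and trace preserving with Hilbert–Schmidt adjoint $\Phi^*$, let $E_{\mathrm{fix}}$ be a conditional expectation onto the fixed point algebra of $\Phi^*$, and let $\{|||\cdot|||_{L^{(n)}}\}_{n\ge1}$ be a matrix Lipschitz semi-norm on $\mathbb M_d$. Suppose $\Phi^*\circ E_{\mathrm{fix}}=E_{\mathrm{fix}}\circ\Phi^*=E_{\mathrm{fix}}$ and $\mathrm{Lip}_L^{cb}(\Phi^* )<1$. Then for every $\varepsilon>0$, $$t_{\mathrm{mix}}^L(\varepsilon,\Phi^* )\le\frac{\log(1/\varepsilon)}{-\log\bigl(\mathrm{Lip}_L^{cb}(\Phi^* )\bigr)}.$$
   Context: A matrix Lipschitz semi-norm on $\mathcal N$ is a family of semi-norms $|||\cdot|||_{L^{(n)}}:\mathbb M_n(\mathcal N)\to[0,\infty)$, $n\ge1$, such that (1) $|||\mathbf 1|||_{L^{(n)}}=0$; (2) $|||x|||_{L^{(n)}}=|||x^*|||_{L^{(n)}}$; (3) $|||x\oplus y|||_{L^{(n+m)}}=\max\{|||x|||_{L^{(n)}},|||y|||_{L^{(m)}}\}$ for $x\in\mathbb M_n(\mathcal N)$, $y\in\mathbb M_m(\mathcal N)$; (4) $|||axb|||_{L^{(m)}}\le\|a\|_{op}|||x|||_{L^{(n)}}\|b\|_{op}$ for $x\in\mathbb M_n(\mathcal N)$ and scalar matrices $a\in\mathbb M_{m\times n}$, $b\in\mathbb M_{n\times m}$. For a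 unital completely positive map $\Psi:\mathcal N\to\mathcal N$ let $\Psi^{(n)}=\mathrm{id}_{\mathbb M_n}\otimes\Psi$ and $$\mathrm{Cost}_L^{cb}(\Psi)=\sup_{n\ge1}\sup\{\|\Psi^{(n)}(x)-x\|_{op}: x=x^*\in\mathbb M_n(\mathcal N),\ |||x|||_{L^{(n)}}\le1\},$$ $$\mathrm{Lip}_L^{cb}(\Psi)=\sup_{n\ge1}\sup\{|||\Psi^{(n)}(x)|||_{L^{(n)}}: x=x^*\in\mathbb M_n(\mathcal N),\ |||x|||_{L^{(n)}}\le1\}.$$ The cost induced mixing time is $$t_{\mathrm{mix}}^L(\varepsilon,\Phi^* )=\inf\{n\ge1: \mathrm{Cost}_L^{cb}((\Phi^* )^n)\ge(1-\varepsilon)\,\mathrm{Cost}_L^{cb}(E_{\mathrm{fix}})\}.$$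
   Formalization: The right-hand side R is replaced by max(1, ⌈R⌉): as the mixing time is an integer at least 1, the displayed bound fails for ε ≥ 1 and, for a depolarizing map with Lip = 1/2, whenever R is not an integer. *)

theory Defs
  imports
    "HOL-Library.Extended_Real"
    "Jordan_Normal_Form.Schur_Decomposition"
begin

(* M_n(M_d) is identified with M_{nd}: its elements are the matrices of dimension (n * d) x (n * d),
   and the M_d-valued entry (p, q) is the d x d block in block position (p, q).  Under this
   identification the involution, unit, order and operator norm of M_n(M_d) are those of M_{nd},
   and the product by a scalar matrix a is the product by the Kronecker product of a and 1. *)

definition kron :: "complex mat \<Rightarrow> complex mat \<Rightarrow> complex mat" where
  "kron a b = mat (dim_row a * dim_row b) (dim_col a * dim_col b)
     (\<lambda>(i, j). a $$ (i div dim_row b, j div dim_col b) * b $$ (i mod dim_row b, j mod dim_col b))"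

definition block_at :: "nat \<Rightarrow> complex mat \<Rightarrow> nat \<Rightarrow> nat \<Rightarrow> complex mat" where
  "block_at d X p q = mat d d (\<lambda>(r, s). X $$ (p * d + r, q * d + s))"

(* id_{M_n} \<otimes> \<Psi>, i.e. \<Psi> applied to each block. *)
definition amplify ::
  "nat \<Rightarrow> nat \<Rightarrow> (complex mat \<Rightarrow> complex mat) \<Rightarrow> complex mat \<Rightarrow> complex mat" where
  "amplify d n \<Psi> X = mat (n * d) (n * d)
     (\<lambda>(i, j). \<Psi> (block_at d X (i div d) (j div d)) $$ (i mod d, j mod d))"

definition direct_sum :: "complex mat \<Rightarrow> complex mat \<Rightarrow> complex mat" where
  "direct_sum x y = four_block_mat x (0\<^sub>m (dim_row x) (dim_col y)) (0\<^sub>m (dim_row y) (dim_col x)) y"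

definition l2_norm :: "complex vec \<Rightarrow> real" where
  "l2_norm v = sqrt (\<Sum>i<dim_vec v. (cmod (v $ i))\<^sup>2)"

definition op_norm :: "complex mat \<Rightarrow> real" where
  "op_norm A = (SUP v\<in>{v \<in> carrier_vec (dim_col A). l2_norm v \<le> 1}. l2_norm (A *\<^sub>v v))"

definition mat_trace :: "complex mat \<Rightarrow> complex" where
  "mat_trace A = (\<Sum>i<dim_row A. A $$ (i, i))"

definition self_adjoint :: "complex mat \<Rightarrow> bool" where
  "self_adjoint x \<longleftrightarrow> mat_adjoint x = x"

definition pos_semidef :: "complex mat \<Rightarrow> bool" where
  "pos_semidef A \<longleftrightarrow> self_adjoint A \<and>
     (\<forall>v\<in>carrier_vec (dim_col A). Re ((A *\<^sub>v v) \<bullet> conjugate v) \<ge> 0)"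

definition linear_map :: "nat \<Rightarrow> (complex mat \<Rightarrow> complex mat) \<Rightarrow> bool" where
  "linear_map d \<Psi> \<longleftrightarrow>
     (\<forall>x\<in>carrier_mat d d. \<Psi> x \<in> carrier_mat d d) \<and>
     (\<forall>x\<in>carrier_mat d d. \<forall>y\<in>carrier_mat d d. \<Psi> (x + y) = \<Psi> x + \<Psi> y) \<and>
     (\<forall>c. \<forall>x\<in>carrier_mat d d. \<Psi> (c \<cdot>\<^sub>m x) = c \<cdot>\<^sub>m \<Psi> x)"

definition completely_positive :: "nat \<Rightarrow> (complex mat \<Rightarrow> complex mat) \<Rightarrow> bool" where
  "completely_positive d \<Psi> \<longleftrightarrow> linear_map d \<Psi> \<and>
     (\<forall>n\<ge>1. \<forall>X\<in>carrier_mat (n * d) (n * d). pos_semidef X \<longrightarrow> pos_semidef (amplify d n \<Psi> X))"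

definition trace_preserving :: "nat \<Rightarrow> (complex mat \<Rightarrow> complex mat) \<Rightarrow> bool" where
  "trace_preserving d \<Psi> \<longleftrightarrow> (\<forall>x\<in>carrier_mat d d. mat_trace (\<Psi> x) = mat_trace x)"

(* \<Psi>' is the adjoint of \<Psi> for the inner product tr (x* y); this determines \<Psi>' on M_d. *)
definition hs_adjoint ::
  "nat \<Rightarrow> (complex mat \<Rightarrow> complex mat) \<Rightarrow> (complex mat \<Rightarrow> complex mat) \<Rightarrow> bool" where
  "hs_adjoint d \<Psi> \<Psi>' \<longleftrightarrow>
     (\<forall>x\<in>carrier_mat d d. \<Psi>' x \<in> carrier_mat d d) \<and>
     (\<forall>x\<in>carrier_mat d d. \<forall>y\<in>carrier_mat d d.
        mat_trace (mat_adjoint (\<Psi> x) * y) = mat_trace (mat_adjoint x * \<Psi>' y))"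

definition fixed_points :: "nat \<Rightarrow> (complex mat \<Rightarrow> complex mat) \<Rightarrow> complex mat set" where
  "fixed_points d \<Psi> = {x \<in> carrier_mat d d. \<Psi> x = x}"

definition unital_star_subalgebra :: "nat \<Rightarrow> complex mat set \<Rightarrow> bool" where
  "unital_star_subalgebra d F \<longleftrightarrow> F \<subseteq> carrier_mat d d \<and> 1\<^sub>m d \<in> F \<and>
     (\<forall>x\<in>F. \<forall>y\<in>F. x + y \<in> F \<and> x * y \<in> F) \<and>
     (\<forall>c. \<forall>x\<in>F. c \<cdot>\<^sub>m x \<in> F) \<and>
     (\<forall>x\<in>F. mat_adjoint x \<in> F)"

(* Unitality is the case x = 1 of E x = x; complete positivity follows from positivity and the
   bimodule property. *)
definition conditional_expectation ::
  "nat \<Rightarrow> complex mat set \<Rightarrow> (complex mat \<Rightarrow> complex mat) \<Rightarrow> bool" where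
  "conditional_expectation d F E \<longleftrightarrow>
     unital_star_subalgebra d F \<and>
     linear_map d E \<and>
     (\<forall>x\<in>carrier_mat d d. pos_semidef x \<longrightarrow> pos_semidef (E x)) \<and>
     (\<forall>x\<in>carrier_mat d d. E x \<in> F) \<and>
     (\<forall>x\<in>F. E x = x) \<and>
     (\<forall>a\<in>F. \<forall>b\<in>F. \<forall>x\<in>carrier_mat d d. E (a * x * b) = a * E x * b)"

(* L n is the semi-norm on M_n(M_d); its values off carrier_mat (n * d) (n * d), and L 0, are
   irrelevant. *)
definition matrix_lipschitz_seminorm :: "nat \<Rightarrow> (nat \<Rightarrow> complex mat \<Rightarrow> real) \<Rightarrow> bool" where
  "matrix_lipschitz_seminorm d L \<longleftrightarrow>
     (\<forall>n\<ge>1. \<forall>x\<in>carrier_mat (n * d) (n * d). L n x \<ge> 0) \<and>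
     (\<forall>n\<ge>1. \<forall>x\<in>carrier_mat (n * d) (n * d). \<forall>y\<in>carrier_mat (n * d) (n * d).
        L n (x + y) \<le> L n x + L n y) \<and>
     (\<forall>n\<ge>1. \<forall>c. \<forall>x\<in>carrier_mat (n * d) (n * d). L n (c \<cdot>\<^sub>m x) = cmod c * L n x) \<and>
     (\<forall>n\<ge>1. L n (1\<^sub>m (n * d)) = 0) \<and>
     (\<forall>n\<ge>1. \<forall>x\<in>carrier_mat (n * d) (n * d). L n x = L n (mat_adjoint x)) \<and>
     (\<forall>n\<ge>1. \<forall>m\<ge>1. \<forall>x\<in>carrier_mat (n * d) (n * d). \<forall>y\<in>carrier_mat (m * d) (m * d).
        L (n + m) (direct_sum x y) = max (L n x) (L m y)) \<and>
     (\<forall>n\<ge>1. \<forall>m\<ge>1. \<forall>x\<in>carrier_mat (n * d) (n * d).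
        \<forall>a\<in>carrier_mat m n. \<forall>b\<in>carrier_mat n m.
        L m (kron a (1\<^sub>m d) * x * kron b (1\<^sub>m d)) \<le> op_norm a * L n x * op_norm b)"

definition lipschitz_ball ::
  "nat \<Rightarrow> (nat \<Rightarrow> complex mat \<Rightarrow> real) \<Rightarrow> nat \<Rightarrow> complex mat set" where
  "lipschitz_ball d L n = {x \<in> carrier_mat (n * d) (n * d). self_adjoint x \<and> L n x \<le> 1}"

definition cost_cb ::
  "nat \<Rightarrow> (nat \<Rightarrow> complex mat \<Rightarrow> real) \<Rightarrow> (complex mat \<Rightarrow> complex mat) \<Rightarrow> ereal" where
  "cost_cb d L \<Psi> =
     (SUP n\<in>{1..}. SUP x\<in>lipschitz_ball d L n. ereal (op_norm (amplify d n \<Psi> x - x)))"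

definition lip_cb ::
  "nat \<Rightarrow> (nat \<Rightarrow> complex mat \<Rightarrow> real) \<Rightarrow> (complex mat \<Rightarrow> complex mat) \<Rightarrow> ereal" where
  "lip_cb d L \<Psi> =
     (SUP n\<in>{1..}. SUP x\<in>lipschitz_ball d L n. ereal (L n (amplify d n \<Psi> x)))"

(* The infimum of the empty set is \<infinity>.  Costs may be infinite, and 0 * \<infinity> = 0 in ereal. *)
definition mixing_time ::
  "nat \<Rightarrow> (nat \<Rightarrow> complex mat \<Rightarrow> real) \<Rightarrow> (complex mat \<Rightarrow> complex mat) \<Rightarrow> real \<Rightarrow>
   (complex mat \<Rightarrow> complex mat) \<Rightarrow> ereal" where
  "mixing_time d L E \<epsilon> \<Psi> =
     (INF n\<in>{n. n \<ge> 1 \<and> cost_cb d L (\<Psi> ^^ n) \<ge> ereal (1 - \<epsilon>) * cost_cb d L E}. ereal (real n))"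

(* Conventions for a bound of the form log (1 / \<epsilon>) / (- log l) on the mixing time.  At l = 0 the
   ratio is 0, because - log 0 = \<infinity>; ln 0 = 0 and division by 0 give that value in Isabelle.  The
   mixing time is an integer and at least 1 while the ratio is an arbitrary real, so the bound
   holds for the least integer n \<ge> 1 above the ratio, i.e. max 1 \<lceil>ratio\<rceil>. *)

end

(* Write T for \<Phi>s and l for its Lipschitz constant.  As E T = E, comparing x with E x = E (T^N x)
   through T^N x gives Cost(E) \<le> Cost(T^N) + l^N Cost(E), hence the bound with l^N \<le> \<epsilon> if Cost(E)
   is finite.  If it is infinite, then so is Cost(T) and the mixing time is 1: were Cost(T) = c
   finite, the increments of T^k x would be bounded by c l^k, so T^k x would converge to a fixed
   point, which must be E x, at distance at most c / (1 - l) from x. *)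

theory Submission
  imports Defs "HOL-Analysis.L2_Norm"
begin

text \<open>A cost can be infinite, for instance if \<open>L = 0\<close> and E is not the identity.
  The comparison of Cost(E) with Cost(T^N) then has the same infinity on both sides, which is why a
  limit argument is needed in that case. Both suprema run only over self-adjoint elements of the
  unit ball of the semi-norm. Using them along the orbit of x therefore requires that T^k x stay
  self-adjoint and that the bounds be made homogeneous, also where the semi-norm vanishes. T is
  given only through the trace pairing with \<Phi>. Its linearity and its compatibility with the
  involution have to be extracted from \<Phi>, the latter from complete positivity. Limits are taken
  entry by entry: an entry is bounded by the operator norm, and the operator norm by the sum of the
  moduli of the entries.\<close>

section \<open>Euclidean and operator norms\<close>

lemma l2_norm_eq_L2_set: "l2_norm v = L2_set (\<lambda>i. cmod (v $ i)) {..<dim_vec v}"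
  by (simp add: l2_norm_def L2_set_def)

lemma l2_norm_nonneg: "0 \<le> l2_norm v"
  by (simp add: l2_norm_def sum_nonneg)

lemma l2_norm_zero: "l2_norm (0\<^sub>v n) = 0"
  by (simp add: l2_norm_def)

lemma l2_norm_add_le:
  assumes "dim_vec v = dim_vec w"
  shows "l2_norm (v + w) \<le> l2_norm v + l2_norm w"
proof -
  have "l2_norm (v + w) = L2_set (\<lambda>i. cmod (v $ i + w $ i)) {..<dim_vec w}"
    by (simp add: l2_norm_eq_L2_set cong: L2_set_cong_simp)
  also have "\<dots> \<le> L2_set (\<lambda>i. cmod (v $ i) + cmod (w $ i)) {..<dim_vec w}"
    by (rule L2_set_mono) (auto intro: norm_triangle_ineq)
  also have "\<dots> \<le> l2_norm v + l2_norm w"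
    unfolding l2_norm_eq_L2_set assms by (rule L2_set_triangle_ineq)
  finally show ?thesis .
qed

lemma l2_norm_smult: "l2_norm (c \<cdot>\<^sub>v v) = cmod c * l2_norm v"
proof -
  have "l2_norm (c \<cdot>\<^sub>v v) = L2_set (\<lambda>i. cmod c * cmod (v $ i)) {..<dim_vec v}"
    by (simp add: l2_norm_eq_L2_set norm_mult cong: L2_set_cong_simp)
  then show ?thesis
    by (simp add: l2_norm_eq_L2_set L2_set_right_distrib)
qed

lemma cmod_index_le_l2_norm: "i < dim_vec v \<Longrightarrow> cmod (v $ i) \<le> l2_norm v"
  unfolding l2_norm_eq_L2_set by (rule member_le_L2_set) auto

text \<open>A supremum of reals is informative only for a bounded set, and this crude bound makes
  the set defining \<open>op_norm\<close> bounded. It also lets entrywise convergence control the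
  operator norm.\<close>

lemma l2_norm_mult_vec_le_sum:
  assumes "v \<in> carrier_vec (dim_col A)" "l2_norm v \<le> 1"
  shows "l2_norm (A *\<^sub>v v) \<le> (\<Sum>i<dim_row A. \<Sum>j<dim_col A. cmod (A $$ (i, j)))"
proof -
  have "l2_norm (A *\<^sub>v v) \<le> (\<Sum>i<dim_vec (A *\<^sub>v v). cmod ((A *\<^sub>v v) $ i))"
    unfolding l2_norm_eq_L2_set by (rule L2_set_le_sum) simp
  also have "\<dots> = (\<Sum>i<dim_row A. cmod ((A *\<^sub>v v) $ i))"
    by simp
  also have "\<dots> \<le> (\<Sum>i<dim_row A. \<Sum>j<dim_col A. cmod (A $$ (i, j)))"
  proof (rule sum_mono)
    fix i assume i: "i \<in> {..<dim_row A}"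
    have "(A *\<^sub>v v) $ i = (\<Sum>j<dim_col A. A $$ (i, j) * v $ j)"
      using i assms by (auto simp: scalar_prod_def atLeast0LessThan intro!: sum.cong)
    also have "cmod \<dots> \<le> (\<Sum>j<dim_col A. cmod (A $$ (i, j) * v $ j))"
      by (rule norm_sum)
    also have "\<dots> \<le> (\<Sum>j<dim_col A. cmod (A $$ (i, j)))"
    proof (rule sum_mono)
      fix j assume "j \<in> {..<dim_col A}"
      then have "cmod (v $ j) \<le> 1"
        using cmod_index_le_l2_norm[of j v] assms by auto
      then show "cmod (A $$ (i, j) * v $ j) \<le> cmod (A $$ (i, j))"
        by (simp add: norm_mult mult_left_le)
    qed
    finally show "cmod ((A *\<^sub>v v) $ i) \<le> (\<Sum>j<dim_col A. cmod (A $$ (i, j)))" .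
  qed
  finally show ?thesis .
qed

lemma l2_norm_mult_vec_le_op_norm:
  assumes "v \<in> carrier_vec (dim_col A)" "l2_norm v \<le> 1"
  shows "l2_norm (A *\<^sub>v v) \<le> op_norm A"
  unfolding op_norm_def
proof (rule cSUP_upper)
  show "bdd_above ((\<lambda>v. l2_norm (A *\<^sub>v v)) ` {v \<in> carrier_vec (dim_col A). l2_norm v \<le> 1})"
    using l2_norm_mult_vec_le_sum[of _ A] by (intro bdd_aboveI2) blast
qed (use assms in auto)

lemma op_norm_leI:
  assumes "\<And>v. v \<in> carrier_vec (dim_col A) \<Longrightarrow> l2_norm v \<le> 1 \<Longrightarrow> l2_norm (A *\<^sub>v v) \<le> c"
  shows "op_norm A \<le> c"
  unfolding op_norm_def
proof (rule cSUP_least)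
  show "{v \<in> carrier_vec (dim_col A). l2_norm v \<le> 1} \<noteq> {}"
    using l2_norm_zero[of "dim_col A"] by (auto intro!: exI[of _ "0\<^sub>v (dim_col A)"])
qed (use assms in auto)

lemma op_norm_le_sum: "op_norm A \<le> (\<Sum>i<dim_row A. \<Sum>j<dim_col A. cmod (A $$ (i, j)))"
  by (intro op_norm_leI l2_norm_mult_vec_le_sum)

lemma op_norm_nonneg: "0 \<le> op_norm A"
  using l2_norm_mult_vec_le_op_norm[of "0\<^sub>v (dim_col A)" A] l2_norm_nonneg[of "A *\<^sub>v 0\<^sub>v (dim_col A)"]
  by (simp add: l2_norm_zero)

lemma op_norm_add_le:
  assumes "A \<in> carrier_mat m n" "B \<in> carrier_mat m n"
  shows "op_norm (A + B) \<le> op_norm A + op_norm B"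
proof (rule op_norm_leI)
  fix v assume v: "v \<in> carrier_vec (dim_col (A + B))" "l2_norm v \<le> 1"
  have "l2_norm ((A + B) *\<^sub>v v) = l2_norm (A *\<^sub>v v + B *\<^sub>v v)"
    using assms v by (subst add_mult_distrib_mat_vec) auto
  also have "\<dots> \<le> l2_norm (A *\<^sub>v v) + l2_norm (B *\<^sub>v v)"
    by (rule l2_norm_add_le) (use assms in auto)
  also have "\<dots> \<le> op_norm A + op_norm B"
    using assms v by (intro add_mono l2_norm_mult_vec_le_op_norm) auto
  finally show "l2_norm ((A + B) *\<^sub>v v) \<le> op_norm A + op_norm B" .
qed

lemma op_norm_diff_triangle:
  assumes "A \<in> carrier_mat m n" "B \<in> carrier_mat m n" "C \<in> carrier_mat m n"
  shows "op_norm (A - C) \<le> op_norm (A - B) + op_norm (B - C)"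
proof -
  have "A - C = (A - B) + (B - C)"
    using assms by auto
  then show ?thesis
    using assms op_norm_add_le[of "A - B" m n "B - C"] by (metis minus_carrier_mat)
qed

lemma op_norm_smult: "op_norm (c \<cdot>\<^sub>m A) = cmod c * op_norm A"
proof -
  \<comment> \<open>This half is proved for all \<open>c\<close> and \<open>A\<close>, because the
    reverse inequality is its instance for \<open>inverse c\<close> and
    \<open>c \<cdot>\<^sub>m A\<close>.\<close>
  have le: "op_norm (c \<cdot>\<^sub>m A) \<le> cmod c * op_norm A" for c A
  proof (rule op_norm_leI)
    fix v assume v: "v \<in> carrier_vec (dim_col (c \<cdot>\<^sub>m A))" "l2_norm v \<le> 1"
    have "(c \<cdot>\<^sub>m A) *\<^sub>v v = c \<cdot>\<^sub>v (A *\<^sub>v v)"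
      using v by (intro eq_vecI) auto
    then show "l2_norm ((c \<cdot>\<^sub>m A) *\<^sub>v v) \<le> cmod c * op_norm A"
      using v by (simp add: l2_norm_smult mult_left_mono l2_norm_mult_vec_le_op_norm)
  qed
  show ?thesis
  proof (cases "c = 0")
    case True
    then show ?thesis
      using le[of 0 A] op_norm_nonneg[of "0 \<cdot>\<^sub>m A"] by simp
  next
    case False
    then have "inverse c \<cdot>\<^sub>m (c \<cdot>\<^sub>m A) = A"
      by (intro eq_matI) auto
    then have "op_norm A \<le> inverse (cmod c) * op_norm (c \<cdot>\<^sub>m A)"
      using le[of "inverse c" "c \<cdot>\<^sub>m A"] by (simp add: norm_inverse)
    then have "cmod c * op_norm A \<le> op_norm (c \<cdot>\<^sub>m A)"
      using False by (simp add: field_simps)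
    then show ?thesis
      using le[of c A] by simp
  qed
qed

text \<open>An entry is a coordinate of the image of a unit vector. This carries geometric decay in
  operator norm over to every entry.\<close>

lemma cmod_index_le_op_norm:
  assumes "i < dim_row A" "j < dim_col A"
  shows "cmod (A $$ (i, j)) \<le> op_norm A"
proof -
  have "l2_norm (unit_vec (dim_col A) j) = 1"
    using assms by (simp add: l2_norm_def unit_vec_def if_distrib[of "\<lambda>x. x\<^sup>2"] if_distrib[of cmod] cong: if_cong)
  then have "l2_norm (A *\<^sub>v unit_vec (dim_col A) j) \<le> op_norm A"
    by (intro l2_norm_mult_vec_le_op_norm) auto
  moreover have "cmod ((A *\<^sub>v unit_vec (dim_col A) j) $ i) \<le> l2_norm (A *\<^sub>v unit_vec (dim_col A) j)"
    using assms by (intro cmod_index_le_l2_norm) auto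
  ultimately show ?thesis
    using assms by simp
qed

section \<open>Adjoints, the trace pairing and matrix units\<close>

lemma mat_adjoint_dim [simp]:
  "dim_row (mat_adjoint A) = dim_col A" "dim_col (mat_adjoint A) = dim_row A"
  by (auto simp: mat_adjoint_def)

lemma mat_adjoint_index [simp]:
  fixes A :: "complex mat"
  assumes "i < dim_col A" "j < dim_row A"
  shows "mat_adjoint A $$ (i, j) = cnj (A $$ (j, i))"
  using assms by (simp add: mat_adjoint_def mat_of_rows_index)

lemma self_adjoint_iff:
  assumes "A \<in> carrier_mat n n"
  shows "self_adjoint A \<longleftrightarrow> (\<forall>i<n. \<forall>j<n. cnj (A $$ (j, i)) = A $$ (i, j))"
proof
  assume "self_adjoint A"
  then show "\<forall>i<n. \<forall>j<n. cnj (A $$ (j, i)) = A $$ (i, j)"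
    using assms unfolding self_adjoint_def by (metis carrier_matD mat_adjoint_index)
next
  assume "\<forall>i<n. \<forall>j<n. cnj (A $$ (j, i)) = A $$ (i, j)"
  then show "self_adjoint A"
    using assms unfolding self_adjoint_def by (intro eq_matI) auto
qed

lemma mat_trace_mat_adjoint_mult:
  assumes "A \<in> carrier_mat d d" "B \<in> carrier_mat d d"
  shows "mat_trace (mat_adjoint A * B) = (\<Sum>k<d. \<Sum>l<d. cnj (A $$ (k, l)) * B $$ (k, l))"
proof -
  have "mat_trace (mat_adjoint A * B) = (\<Sum>l<d. \<Sum>k<d. cnj (A $$ (k, l)) * B $$ (k, l))"
    using assms by (auto simp: mat_trace_def scalar_prod_def atLeast0LessThan intro!: sum.cong)
  then show ?thesis
    by (subst sum.swap) simp
qed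

definition matrix_unit :: "nat \<Rightarrow> nat \<Rightarrow> nat \<Rightarrow> complex mat" where
  "matrix_unit d i j = mat d d (\<lambda>(k, l). if k = i \<and> l = j then 1 else 0)"

lemma matrix_unit_carrier [simp]: "matrix_unit d i j \<in> carrier_mat d d"
  by (simp add: matrix_unit_def)

lemma matrix_unit_dim [simp]: "dim_row (matrix_unit d i j) = d" "dim_col (matrix_unit d i j) = d"
  by (simp_all add: matrix_unit_def)

lemma sum_two_deltas:
  fixes f :: "nat \<Rightarrow> nat \<Rightarrow> complex"
  assumes "i < d" "j < d"
  shows "(\<Sum>k<d. \<Sum>l<d. (if k = i \<and> l = j then f k l else 0)) = f i j"
proof -
  have "(\<Sum>k<d. \<Sum>l<d. (if k = i \<and> l = j then f k l else 0))
      = (\<Sum>k<d. if k = i then f k j else 0)"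
    using assms by (intro sum.cong) (auto)
  then show ?thesis
    using assms by simp
qed

lemma mat_trace_matrix_unit_mult:
  assumes "i < d" "j < d" "B \<in> carrier_mat d d"
  shows "mat_trace (mat_adjoint (matrix_unit d i j) * B) = B $$ (i, j)"
proof -
  have "mat_trace (mat_adjoint (matrix_unit d i j) * B)
      = (\<Sum>k<d. \<Sum>l<d. (if k = i \<and> l = j then B $$ (k, l) else 0))"
    using assms by (subst mat_trace_mat_adjoint_mult[of _ d])
      (auto simp: matrix_unit_def intro!: sum.cong)
  then show ?thesis
    using assms by (simp add: sum_two_deltas)
qed

section \<open>Linear maps in coordinates\<close>

text \<open>The matrix of a linear map on M_d with respect to the matrix units. In this form
  linearity, compatibility with the involution and entrywise continuity become statements about
  finite sums.\<close>

definition kernel_map ::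
  "nat \<Rightarrow> (nat \<Rightarrow> nat \<Rightarrow> nat \<Rightarrow> nat \<Rightarrow> complex) \<Rightarrow> complex mat \<Rightarrow> complex mat" where
  "kernel_map d K x = mat d d (\<lambda>(i, j). \<Sum>k<d. \<Sum>l<d. K i j k l * x $$ (k, l))"

lemma kernel_map_carrier [simp]: "kernel_map d K x \<in> carrier_mat d d"
  by (simp add: kernel_map_def)

lemma kernel_map_index:
  "i < d \<Longrightarrow> j < d \<Longrightarrow> kernel_map d K x $$ (i, j) = (\<Sum>k<d. \<Sum>l<d. K i j k l * x $$ (k, l))"
  by (simp add: kernel_map_def)

lemma linear_map_kernel_map: "linear_map d (kernel_map d K)"
  unfolding linear_map_def
proof (intro conjI ballI allI)
  fix x y :: "complex mat" assume "x \<in> carrier_mat d d" "y \<in> carrier_mat d d"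
  then show "kernel_map d K (x + y) = kernel_map d K x + kernel_map d K y"
    by (intro eq_matI)
      (auto simp: kernel_map_def distrib_left sum.distrib)
next
  fix c and x :: "complex mat" assume "x \<in> carrier_mat d d"
  then show "kernel_map d K (c \<cdot>\<^sub>m x) = c \<cdot>\<^sub>m kernel_map d K x"
    by (intro eq_matI)
      (auto simp: kernel_map_def sum_distrib_left mult.left_commute)
qed simp

lemma linear_map_cong:
  assumes "linear_map d \<Psi>" "\<And>x. x \<in> carrier_mat d d \<Longrightarrow> \<Psi>' x = \<Psi> x"
  shows "linear_map d \<Psi>'"
  using assms unfolding linear_map_def by simp

lemma linear_map_eq_kernel_map:
  assumes "linear_map d \<Psi>" "x \<in> carrier_mat d d"
  shows "\<Psi> x = kernel_map d (\<lambda>i j k l. \<Psi> (matrix_unit d k l) $$ (i, j)) x"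
proof -
  have add: "\<Psi> (y + z) = \<Psi> y + \<Psi> z" if "y \<in> carrier_mat d d" "z \<in> carrier_mat d d" for y z
    using assms that by (auto simp: linear_map_def)
  have smult: "\<Psi> (c \<cdot>\<^sub>m y) = c \<cdot>\<^sub>m \<Psi> y" if "y \<in> carrier_mat d d" for c y
    using assms that by (auto simp: linear_map_def)
  have carrier: "\<Psi> y \<in> carrier_mat d d" if "y \<in> carrier_mat d d" for y
    using assms that by (auto simp: linear_map_def)
  \<comment> \<open>\<open>part S\<close> keeps the entries of \<open>x\<close> at the positions in
    \<open>S\<close>. A new position adds a multiple of one matrix unit, so binary additivity
    suffices for an induction over \<open>S\<close>.\<close>
  define part where
    "part S = mat d d (\<lambda>(k, l). if (k, l) \<in> S then x $$ (k, l) else 0)" for S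
  have part_carrier: "part S \<in> carrier_mat d d" for S
    by (simp add: part_def)
  have "\<Psi> (part S) $$ (i, j) = (\<Sum>(k, l)\<in>S. \<Psi> (matrix_unit d k l) $$ (i, j) * x $$ (k, l))"
    if "finite S" "i < d" "j < d" for S i j
    using that(1)
  proof (induction S rule: finite_induct)
    case empty
    \<comment> \<open>The value at the zero matrix comes from homogeneity with scalar 0.\<close>
    have "part {} = 0 \<cdot>\<^sub>m part {}"
      by (intro eq_matI) (auto simp: part_def)
    then have "\<Psi> (part {}) = 0 \<cdot>\<^sub>m \<Psi> (part {})"
      using smult[OF part_carrier] by metis
    then have "\<Psi> (part {}) $$ (i, j) = (0 \<cdot>\<^sub>m \<Psi> (part {})) $$ (i, j)"
      by simp
    also have "\<dots> = 0"
      using carrier[OF part_carrier[of "{}"]] that by simp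
    finally show ?case
      by simp
  next
    case (insert p S)
    obtain k l where p: "p = (k, l)"
      by force
    have "part (insert p S) = x $$ (k, l) \<cdot>\<^sub>m matrix_unit d k l + part S"
      using insert(2) by (intro eq_matI) (auto simp: part_def matrix_unit_def p)
    then have "\<Psi> (part (insert p S)) = x $$ (k, l) \<cdot>\<^sub>m \<Psi> (matrix_unit d k l) + \<Psi> (part S)"
      by (simp add: add smult part_carrier)
    then show ?case
      using insert carrier[OF part_carrier[of S]] carrier[OF matrix_unit_carrier[of d k l]] that
      by (simp add: p mult.commute)
  qed
  note part_sum = this
  have x: "part ({..<d} \<times> {..<d}) = x"
    using assms by (intro eq_matI) (auto simp: part_def)
  show ?thesis
  proof (rule eq_matI)
    fix i j assume "i < dim_row (kernel_map d (\<lambda>i j k l. \<Psi> (matrix_unit d k l) $$ (i, j)) x)"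
      "j < dim_col (kernel_map d (\<lambda>i j k l. \<Psi> (matrix_unit d k l) $$ (i, j)) x)"
    then show "\<Psi> x $$ (i, j) = kernel_map d (\<lambda>i j k l. \<Psi> (matrix_unit d k l) $$ (i, j)) x $$ (i, j)"
      using part_sum[of "{..<d} \<times> {..<d}" i j]
      by (simp add: x kernel_map_def sum.cartesian_product)
  qed (use carrier[OF assms(2)] in \<open>auto simp: kernel_map_def\<close>)
qed

text \<open>Pairing with a matrix unit reads off one entry, so the trace identity determines the
  adjoint: its kernel is the conjugate transpose of the kernel of \<open>\<Psi>\<close>.\<close>

lemma hs_adjoint_eq_kernel_map:
  assumes "hs_adjoint d \<Psi> \<Psi>'" "linear_map d \<Psi>" "y \<in> carrier_mat d d"
  shows "\<Psi>' y = kernel_map d (\<lambda>i j k l. cnj (\<Psi> (matrix_unit d i j) $$ (k, l))) y"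
    (is "_ = ?R")
proof (rule eq_matI)
  have car: "\<Psi>' y \<in> carrier_mat d d"
    using assms by (auto simp: hs_adjoint_def)
  then show "dim_row (\<Psi>' y) = dim_row ?R" "dim_col (\<Psi>' y) = dim_col ?R"
    by (auto simp: kernel_map_def)
  fix i j assume "i < dim_row ?R" "j < dim_col ?R"
  then have ij: "i < d" "j < d"
    by (auto simp: kernel_map_def)
  have "\<Psi>' y $$ (i, j) = mat_trace (mat_adjoint (\<Psi> (matrix_unit d i j)) * y)"
    using assms ij car by (simp add: hs_adjoint_def mat_trace_matrix_unit_mult)
  also have "\<dots> = ?R $$ (i, j)"
    using assms ij by (subst mat_trace_mat_adjoint_mult[of _ d])
      (auto simp: linear_map_def kernel_map_def)
  finally show "\<Psi>' y $$ (i, j) = ?R $$ (i, j)" .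
qed

text \<open>The quadratic form at \<open>v\<close> is the squared modulus of the pairing
  \<open>z\<close> of \<open>v\<close> with \<open>a\<close>. The Choi matrix below is of this
  kind.\<close>

lemma pos_semidef_rank_one:
  "pos_semidef (mat n n (\<lambda>(i, j). a i * cnj (a j)))"
proof -
  let ?A = "mat n n (\<lambda>(i, j). a i * cnj (a j))"
  have "self_adjoint ?A"
    by (subst self_adjoint_iff[of _ n]) auto
  moreover have "Re ((?A *\<^sub>v v) \<bullet> conjugate v) \<ge> 0" if "v \<in> carrier_vec n" for v
  proof -
    define z where "z = (\<Sum>j<n. cnj (a j) * v $ j)"
    have "(?A *\<^sub>v v) \<bullet> conjugate v = (\<Sum>i<n. (\<Sum>j<n. a i * cnj (a j) * v $ j) * cnj (v $ i))"
      using that by (auto simp: scalar_prod_def atLeast0LessThan intro!: sum.cong)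
    also have "\<dots> = (\<Sum>i<n. z * (a i * cnj (v $ i)))"
      by (auto simp: z_def sum_distrib_left sum_distrib_right mult_ac intro!: sum.cong)
    also have "\<dots> = z * cnj z"
      by (simp add: z_def sum_distrib_left)
    finally show ?thesis
      by (simp add: complex_norm_square[symmetric])
  qed
  ultimately show ?thesis
    by (simp add: pos_semidef_def)
qed

section \<open>Blocks and amplification\<close>

lemma block_index_less:
  fixes p r d n :: nat
  assumes "p < n" "r < d"
  shows "p * d + r < n * d"
proof -
  have "p * d + r < Suc p * d"
    using assms by simp
  also have "\<dots> \<le> n * d"
    using assms by (intro mult_right_mono) auto
  finally show ?thesis .
qed

lemma div_mod_block_index:
  fixes i d n :: nat
  assumes "i < n * d"
  shows "i div d < n" "i mod d < d"
proof -
  have "d > 0"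
    using assms by (cases d) auto
  then show "i div d < n" "i mod d < d"
    using assms by (auto simp: less_mult_imp_div_less)
qed

lemma block_at_carrier [simp]: "block_at d X p q \<in> carrier_mat d d"
  by (simp add: block_at_def)

lemma amplify_carrier [simp]: "amplify d n \<Psi> X \<in> carrier_mat (n * d) (n * d)"
  by (simp add: amplify_def)

lemma amplify_dim [simp]:
  "dim_row (amplify d n \<Psi> X) = n * d" "dim_col (amplify d n \<Psi> X) = n * d"
  by (simp_all add: amplify_def)

lemma amplify_index:
  assumes "i < n * d" "j < n * d"
  shows "amplify d n \<Psi> X $$ (i, j) = \<Psi> (block_at d X (i div d) (j div d)) $$ (i mod d, j mod d)"
  using assms by (simp add: amplify_def)

lemma amplify_cong:
  assumes "\<And>x. x \<in> carrier_mat d d \<Longrightarrow> \<Psi> x = \<Psi>' x"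
  shows "amplify d n \<Psi> X = amplify d n \<Psi>' X"
  using assms by (simp add: amplify_def)

lemma block_at_amplify:
  assumes "p < n" "q < n" "\<Psi> (block_at d X p q) \<in> carrier_mat d d"
  shows "block_at d (amplify d n \<Psi> X) p q = \<Psi> (block_at d X p q)"
  using assms by (intro eq_matI) (auto simp: block_at_def amplify_index block_index_less)

lemma amplify_comp:
  assumes "\<And>x. x \<in> carrier_mat d d \<Longrightarrow> \<Psi>' x \<in> carrier_mat d d"
  shows "amplify d n \<Psi> (amplify d n \<Psi>' X) = amplify d n (\<Psi> \<circ> \<Psi>') X"
  using assms by (intro eq_matI) (auto simp: amplify_index block_at_amplify div_mod_block_index)

lemma amplify_id:
  assumes "X \<in> carrier_mat (n * d) (n * d)"
  shows "amplify d n id X = X"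
  using assms by (intro eq_matI) (auto simp: amplify_index block_at_def div_mod_block_index)

lemma amplify_smult:
  assumes "linear_map d \<Psi>" "X \<in> carrier_mat (n * d) (n * d)"
  shows "amplify d n \<Psi> (c \<cdot>\<^sub>m X) = c \<cdot>\<^sub>m amplify d n \<Psi> X"
proof (rule eq_matI)
  fix i j assume "i < dim_row (c \<cdot>\<^sub>m amplify d n \<Psi> X)" "j < dim_col (c \<cdot>\<^sub>m amplify d n \<Psi> X)"
  then have ij: "i < n * d" "j < n * d"
    by auto
  let ?b = "block_at d X (i div d) (j div d)"
  have "block_at d (c \<cdot>\<^sub>m X) (i div d) (j div d) = c \<cdot>\<^sub>m ?b"
    using ij assms by (intro eq_matI) (auto simp: block_at_def block_index_less div_mod_block_index)
  moreover have "\<Psi> (c \<cdot>\<^sub>m ?b) = c \<cdot>\<^sub>m \<Psi> ?b" "\<Psi> ?b \<in> carrier_mat d d"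
    using assms by (auto simp: linear_map_def)
  ultimately show "amplify d n \<Psi> (c \<cdot>\<^sub>m X) $$ (i, j) = (c \<cdot>\<^sub>m amplify d n \<Psi> X) $$ (i, j)"
    using ij by (auto simp: amplify_index div_mod_block_index)
qed auto

text \<open>In a self-adjoint matrix, opposite blocks are adjoint to each other, and a map commuting
  with the involution preserves this relation.\<close>

lemma self_adjoint_amplify:
  assumes "\<And>x. x \<in> carrier_mat d d \<Longrightarrow> \<Psi> x \<in> carrier_mat d d"
    and star: "\<And>x. x \<in> carrier_mat d d \<Longrightarrow> \<Psi> (mat_adjoint x) = mat_adjoint (\<Psi> x)"
    and X: "X \<in> carrier_mat (n * d) (n * d)" "self_adjoint X"
  shows "self_adjoint (amplify d n \<Psi> X)"
proof (subst self_adjoint_iff[OF amplify_carrier], intro allI impI)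
  fix i j assume ij: "i < n * d" "j < n * d"
  let ?b = "block_at d X (j div d) (i div d)"
  have sa: "cnj (X $$ (l, k)) = X $$ (k, l)" if "k < n * d" "l < n * d" for k l
    using X self_adjoint_iff[of X "n * d"] that by auto
  have "block_at d X (i div d) (j div d) = mat_adjoint ?b"
    using ij by (intro eq_matI)
      (auto simp: block_at_def block_index_less div_mod_block_index sa)
  then have "amplify d n \<Psi> X $$ (i, j) = mat_adjoint (\<Psi> ?b) $$ (i mod d, j mod d)"
    using ij by (simp add: amplify_index star)
  also have "\<dots> = cnj (\<Psi> ?b $$ (j mod d, i mod d))"
    using ij assms(1)[of ?b] by (subst mat_adjoint_index) (auto simp: div_mod_block_index)
  finally show "cnj (amplify d n \<Psi> X $$ (j, i)) = amplify d n \<Psi> X $$ (i, j)"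
    using ij by (simp add: amplify_index)
qed

text \<open>The matrix to which \<open>\<Psi>\<close> is applied is the Choi matrix, the sum of the
  \<open>E\<^sub>p\<^sub>q \<otimes> E\<^sub>p\<^sub>q\<close>; positivity is used only through self-adjointness of the image.\<close>

lemma completely_positive_matrix_unit_adjoint:
  assumes "completely_positive d \<Psi>" "p < d" "q < d" "r < d" "s < d"
  shows "cnj (\<Psi> (matrix_unit d q p) $$ (s, r)) = \<Psi> (matrix_unit d p q) $$ (r, s)"
proof -
  \<comment> \<open>\<open>a\<close> is the identity matrix flattened to a vector of length
    \<open>d * d\<close>. Hence \<open>C\<close> has rank one, and its block at
    \<open>(u, v)\<close> is the matrix unit at \<open>(u, v)\<close>.\<close>
  define a :: "nat \<Rightarrow> complex" where "a i = (if i div d = i mod d then 1 else 0)" for i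
  define C where "C = mat (d * d) (d * d) (\<lambda>(i, j). a i * cnj (a j))"
  have "pos_semidef (amplify d d \<Psi> C)"
    using assms pos_semidef_rank_one[of "d * d" a]
    by (auto simp: completely_positive_def C_def)
  then have sa: "self_adjoint (amplify d d \<Psi> C)"
    by (simp add: pos_semidef_def)
  have block: "block_at d C u v = matrix_unit d u v" if "u < d" "v < d" for u v
    using that by (intro eq_matI)
      (auto simp: block_at_def C_def a_def matrix_unit_def block_index_less)
  have entry: "amplify d d \<Psi> C $$ (u * d + k, v * d + l) = \<Psi> (matrix_unit d u v) $$ (k, l)"
    if "u < d" "v < d" "k < d" "l < d" for u v k l
    using that by (simp add: amplify_index block_index_less block)
  have "cnj (amplify d d \<Psi> C $$ (q * d + s, p * d + r)) = amplify d d \<Psi> C $$ (p * d + r, q * d + s)"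
    using sa assms by (subst (asm) self_adjoint_iff[OF amplify_carrier]) (simp add: block_index_less)
  then show ?thesis
    using assms by (simp add: entry)
qed

section \<open>The Hilbert-Schmidt adjoint of a completely positive map\<close>

lemma hs_adjoint_linear_map:
  assumes "hs_adjoint d \<Psi> \<Psi>'" "linear_map d \<Psi>"
  shows "linear_map d \<Psi>'"
  by (rule linear_map_cong[OF linear_map_kernel_map hs_adjoint_eq_kernel_map[OF assms]])

text \<open>The kernel of \<open>\<Psi>\<close> is Hermitian under exchange of both index pairs, by
  self-adjointness of the amplified Choi matrix. The adjoint inherits this symmetry after the two
  summations are swapped, which is what keeps its iterates inside the self-adjoint elements.\<close>

lemma hs_adjoint_mat_adjoint:
  assumes "hs_adjoint d \<Psi> \<Psi>'" "completely_positive d \<Psi>" "x \<in> carrier_mat d d"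
  shows "\<Psi>' (mat_adjoint x) = mat_adjoint (\<Psi>' x)"
proof -
  have lin: "linear_map d \<Psi>"
    using assms by (simp add: completely_positive_def)
  have x: "mat_adjoint x \<in> carrier_mat d d"
    using assms by auto
  let ?K = "kernel_map d (\<lambda>i j k l. cnj (\<Psi> (matrix_unit d i j) $$ (k, l)))"
  have "?K (mat_adjoint x) = mat_adjoint (?K x)"
  proof (rule eq_matI)
    fix i j assume "i < dim_row (mat_adjoint (?K x))" "j < dim_col (mat_adjoint (?K x))"
    then have ij: "i < d" "j < d"
      by (auto simp: kernel_map_def)
    have "?K (mat_adjoint x) $$ (i, j)
        = (\<Sum>k<d. \<Sum>l<d. cnj (\<Psi> (matrix_unit d i j) $$ (k, l)) * cnj (x $$ (l, k)))"
      using ij assms by (auto simp: kernel_map_index intro!: sum.cong)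
    also have "\<dots> = (\<Sum>l<d. \<Sum>k<d. cnj (\<Psi> (matrix_unit d i j) $$ (k, l)) * cnj (x $$ (l, k)))"
      by (rule sum.swap)
    also have "\<dots> = (\<Sum>l<d. \<Sum>k<d. \<Psi> (matrix_unit d j i) $$ (l, k) * cnj (x $$ (l, k)))"
      using ij completely_positive_matrix_unit_adjoint[OF assms(2)]
      by (intro sum.cong) auto
    also have "\<dots> = mat_adjoint (?K x) $$ (i, j)"
      using ij by (subst mat_adjoint_index) (auto simp: kernel_map_def)
    finally show "?K (mat_adjoint x) $$ (i, j) = mat_adjoint (?K x) $$ (i, j)" .
  qed (auto simp: kernel_map_def)
  then show ?thesis
    using hs_adjoint_eq_kernel_map[OF assms(1) lin] assms x by simp
qed

section \<open>Entrywise limits\<close>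

text \<open>Each entry of the amplification is a finite linear combination, with fixed coefficients,
  of entries of the argument. Continuity therefore needs no norm estimate for
  \<open>\<Psi>\<close>.\<close>

lemma tendsto_amplify:
  assumes "linear_map d \<Psi>"
    and lim: "\<And>i j. i < n * d \<Longrightarrow> j < n * d \<Longrightarrow> (\<lambda>k. X k $$ (i, j)) \<longlonglongrightarrow> Y $$ (i, j)"
    and ij: "i < n * d" "j < n * d"
  shows "(\<lambda>k. amplify d n \<Psi> (X k) $$ (i, j)) \<longlonglongrightarrow> amplify d n \<Psi> Y $$ (i, j)"
proof -
  have entry: "amplify d n \<Psi> Z $$ (i, j) = (\<Sum>k<d. \<Sum>l<d.
      \<Psi> (matrix_unit d k l) $$ (i mod d, j mod d) * Z $$ (i div d * d + k, j div d * d + l))" for Z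
  proof -
    have "\<Psi> (block_at d Z (i div d) (j div d)) $$ (i mod d, j mod d) = (\<Sum>k<d. \<Sum>l<d.
        \<Psi> (matrix_unit d k l) $$ (i mod d, j mod d) * block_at d Z (i div d) (j div d) $$ (k, l))"
      using ij by (subst linear_map_eq_kernel_map[OF assms(1) block_at_carrier])
        (simp add: kernel_map_index div_mod_block_index)
    then show ?thesis
      using ij by (simp add: amplify_index block_at_def)
  qed
  show ?thesis
    unfolding entry using ij
    by (intro tendsto_sum tendsto_mult tendsto_const lim)
      (auto intro!: block_index_less simp: div_mod_block_index)
qed

lemma op_norm_minus_commute:
  assumes "A \<in> carrier_mat m n" "B \<in> carrier_mat m n"
  shows "op_norm (A - B) = op_norm (B - A)"
proof -
  have "A - B = (- 1) \<cdot>\<^sub>m (B - A)"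
    using assms by (intro eq_matI) auto
  then show ?thesis
    by (simp add: op_norm_smult)
qed

text \<open>The distance from \<open>X k\<close> to \<open>Y\<close> is at most the sum of the
  moduli of the entries of \<open>X k - Y\<close>, which tends to 0. Closed balls of the operator
  norm are thus closed under entrywise limits.\<close>

lemma op_norm_diff_limit_le:
  assumes "A \<in> carrier_mat m m" "Y \<in> carrier_mat m m" "\<And>k. X k \<in> carrier_mat m m"
    and lim: "\<And>i j. i < m \<Longrightarrow> j < m \<Longrightarrow> (\<lambda>k. X k $$ (i, j)) \<longlonglongrightarrow> Y $$ (i, j)"
    and le: "\<And>k. op_norm (A - X k) \<le> c"
  shows "op_norm (A - Y) \<le> c"
proof -
  have "(\<lambda>k. c + (\<Sum>i<m. \<Sum>j<m. cmod (X k $$ (i, j) - Y $$ (i, j))))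
      \<longlonglongrightarrow> c + (\<Sum>i<m. \<Sum>j<m. cmod (Y $$ (i, j) - Y $$ (i, j)))"
    by (intro tendsto_intros lim) auto
  then have "(\<lambda>k. c + (\<Sum>i<m. \<Sum>j<m. cmod (X k $$ (i, j) - Y $$ (i, j)))) \<longlonglongrightarrow> c"
    by simp
  moreover have "op_norm (A - Y) \<le> c + (\<Sum>i<m. \<Sum>j<m. cmod (X k $$ (i, j) - Y $$ (i, j)))" for k
  proof -
    have "op_norm (X k - Y) \<le> (\<Sum>i<m. \<Sum>j<m. cmod (X k $$ (i, j) - Y $$ (i, j)))"
      using op_norm_le_sum[of "X k - Y"] assms(2) assms(3)[of k] by simp
    then show ?thesis
      using op_norm_diff_triangle[OF assms(1) assms(3)[of k] assms(2)] le[of k] by linarith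
  qed
  ultimately show ?thesis
    by (intro LIMSEQ_le_const) auto
qed

lemma geometric_increments_op_norm_limit:
  assumes X: "\<And>k. X k \<in> carrier_mat m m"
    and step: "\<And>k. op_norm (X (Suc k) - X k) \<le> c * l ^ k"
    and l: "0 \<le> l" "l < 1" and c: "0 \<le> c"
  obtains Y where "Y \<in> carrier_mat m m"
    and "\<And>i j. i < m \<Longrightarrow> j < m \<Longrightarrow> (\<lambda>k. X k $$ (i, j)) \<longlonglongrightarrow> Y $$ (i, j)"
    and "op_norm (X 0 - Y) \<le> c / (1 - l)"
proof -
  have dims: "dim_row (X k) = m" "dim_col (X k) = m" for k
    using X[of k] by auto
  have geometric: "summable (\<lambda>k. c * l ^ k)"
    using l by (intro summable_mult summable_geometric) auto
  \<comment> \<open>The limit is written as a telescoping series in each entry. Its terms are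
    dominated by \<open>c * l ^ k\<close>, so completeness is needed only for complex
    numbers.\<close>
  define Y where "Y = mat m m (\<lambda>(i, j). X 0 $$ (i, j) + (\<Sum>k. X (Suc k) $$ (i, j) - X k $$ (i, j)))"
  have lim: "(\<lambda>k. X k $$ (i, j)) \<longlonglongrightarrow> Y $$ (i, j)" if ij: "i < m" "j < m" for i j
  proof -
    have "cmod (X (Suc k) $$ (i, j) - X k $$ (i, j)) \<le> c * l ^ k" for k
      using cmod_index_le_op_norm[of i "X (Suc k) - X k" j] step[of k] ij by (simp add: dims)
    then have "summable (\<lambda>k. X (Suc k) $$ (i, j) - X k $$ (i, j))"
      by (intro summable_comparison_test'[OF geometric]) auto
    then have "(\<lambda>k. X 0 $$ (i, j) + (\<Sum>r<k. X (Suc r) $$ (i, j) - X r $$ (i, j)))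
        \<longlonglongrightarrow> X 0 $$ (i, j) + (\<Sum>k. X (Suc k) $$ (i, j) - X k $$ (i, j))"
      by (intro tendsto_add tendsto_const summable_LIMSEQ)
    then show ?thesis
      using ij by (simp add: Y_def sum_lessThan_telescope[of "\<lambda>k. X k $$ (i, j)"])
  qed
  have "op_norm (X 0 - X k) \<le> (\<Sum>r<k. c * l ^ r)" for k
  proof (induction k)
    case 0
    have "X 0 - X 0 = 0 \<cdot>\<^sub>m X 0"
      by (intro eq_matI) auto
    then show ?case
      by (simp add: op_norm_smult)
  next
    case (Suc k)
    have "op_norm (X 0 - X (Suc k)) \<le> op_norm (X 0 - X k) + op_norm (X k - X (Suc k))"
      by (intro op_norm_diff_triangle[of _ m m] X)
    also have "op_norm (X k - X (Suc k)) = op_norm (X (Suc k) - X k)"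
      by (intro op_norm_minus_commute[of _ m m] X)
    finally show ?case
      using Suc step[of k] by simp
  qed
  moreover have "(\<Sum>r<k. c * l ^ r) \<le> c / (1 - l)" for k
  proof -
    have "(\<Sum>r<k. c * l ^ r) \<le> (\<Sum>r. c * l ^ r)"
      using l c geometric by (intro sum_le_suminf) auto
    also have "\<dots> = c / (1 - l)"
      using l by (simp add: suminf_mult suminf_geometric)
    finally show ?thesis .
  qed
  ultimately have "op_norm (X 0 - X k) \<le> c / (1 - l)" for k
    by (rule order_trans)
  then have "op_norm (X 0 - Y) \<le> c / (1 - l)"
    using X lim by (intro op_norm_diff_limit_le[of _ m Y X]) (auto simp: Y_def)
  with lim show ?thesis
    by (intro that[of Y]) (auto simp: Y_def)
qed

section \<open>Homogeneous forms of the cost and Lipschitz bounds\<close>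

lemma self_adjoint_smult_real:
  assumes "X \<in> carrier_mat n n" "self_adjoint X"
  shows "self_adjoint (complex_of_real t \<cdot>\<^sub>m X)"
  using assms by (subst self_adjoint_iff[of _ n]) (auto simp: self_adjoint_iff[of X n])

lemma lipschitz_seminorm_nonneg:
  assumes "matrix_lipschitz_seminorm d L" "n \<ge> 1" "x \<in> carrier_mat (n * d) (n * d)"
  shows "0 \<le> L n x"
  using assms by (auto simp: matrix_lipschitz_seminorm_def)

lemma lipschitz_seminorm_smult:
  assumes "matrix_lipschitz_seminorm d L" "n \<ge> 1" "x \<in> carrier_mat (n * d) (n * d)"
  shows "L n (c \<cdot>\<^sub>m x) = cmod c * L n x"
  using assms unfolding matrix_lipschitz_seminorm_def by blast

text \<open>A supremum over the empty set in \<open>ereal\<close> would be -\<infinity>; this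
  element of the ball makes cost and Lipschitz constant nonnegative.\<close>

lemma zero_in_lipschitz_ball:
  assumes "matrix_lipschitz_seminorm d L" "n \<ge> 1"
  shows "0\<^sub>m (n * d) (n * d) \<in> lipschitz_ball d L n"
proof -
  have "L n (0 \<cdot>\<^sub>m 0\<^sub>m (n * d) (n * d)) = 0"
    using lipschitz_seminorm_smult[OF assms, of "0\<^sub>m (n * d) (n * d)" 0] by simp
  then show ?thesis
    by (auto simp: lipschitz_ball_def self_adjoint_iff[of _ "n * d"])
qed

lemma cost_cb_upper:
  assumes "n \<ge> 1" "x \<in> lipschitz_ball d L n"
  shows "ereal (op_norm (amplify d n \<Psi> x - x)) \<le> cost_cb d L \<Psi>"
  unfolding cost_cb_def using assms by (intro SUP_upper2[of n] SUP_upper2[of x]) auto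

lemma lip_cb_upper:
  assumes "n \<ge> 1" "x \<in> lipschitz_ball d L n"
  shows "ereal (L n (amplify d n \<Psi> x)) \<le> lip_cb d L \<Psi>"
  unfolding lip_cb_def using assms by (intro SUP_upper2[of n] SUP_upper2[of x]) auto

lemma cost_cb_nonneg:
  assumes "matrix_lipschitz_seminorm d L"
  shows "0 \<le> cost_cb d L \<Psi>"
  using cost_cb_upper[OF order_refl zero_in_lipschitz_ball[OF assms order_refl]]
  by (rule order_trans[rotated]) (simp add: op_norm_nonneg)

lemma lip_cb_nonneg:
  assumes "matrix_lipschitz_seminorm d L"
  shows "0 \<le> lip_cb d L \<Psi>"
  using lip_cb_upper[OF order_refl zero_in_lipschitz_ball[OF assms order_refl]]
  by (rule order_trans[rotated]) (simp only: ereal_less_eq zero_ereal_def, rule lipschitz_seminorm_nonneg[OF assms order_refl amplify_carrier])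

lemma cost_cb_leI:
  assumes "\<And>n x. n \<ge> 1 \<Longrightarrow> x \<in> lipschitz_ball d L n \<Longrightarrow> op_norm (amplify d n \<Psi> x - x) \<le> c"
  shows "cost_cb d L \<Psi> \<le> ereal c"
  unfolding cost_cb_def using assms by (intro SUP_least) auto

text \<open>When \<open>L n x = 0\<close> every multiple of \<open>x\<close> lies in the ball; rescaling by
  \<open>L n x + e\<close> for small \<open>e > 0\<close> covers this case as well.\<close>

lemma homogeneous_le_seminorm:
  assumes L: "matrix_lipschitz_seminorm d L" "n \<ge> 1"
    and x: "x \<in> carrier_mat (n * d) (n * d)" "self_adjoint x"
    and ball: "\<And>y. y \<in> lipschitz_ball d L n \<Longrightarrow> f y \<le> c"
    and homogeneous: "\<And>t. 0 < t \<Longrightarrow> f (complex_of_real t \<cdot>\<^sub>m x) = t * f x"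
    and c: "0 \<le> c"
  shows "f x \<le> c * L n x"
proof (rule field_le_epsilon)
  fix e :: real assume e: "0 < e"
  \<comment> \<open>The summand 1 keeps the quotient meaningful for \<open>c = 0\<close>, while
    \<open>c * \<delta>\<close> still stays below \<open>e\<close>.\<close>
  define \<delta> where "\<delta> = e / (c + 1)"
  have \<delta>: "0 < \<delta>" "c * \<delta> \<le> e"
    using e c by (auto simp: \<delta>_def field_simps)
  define s where "s = L n x + \<delta>"
  have Lx: "0 \<le> L n x"
    using lipschitz_seminorm_nonneg[OF L x(1)] .
  then have s: "0 < s"
    using \<delta> by (simp add: s_def)
  have "L n (complex_of_real (1 / s) \<cdot>\<^sub>m x) = L n x / s"
    using s by (subst lipschitz_seminorm_smult[OF L x(1)]) (simp add: norm_divide)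
  also have "\<dots> \<le> 1"
    using s \<delta> by (simp add: s_def)
  finally have "complex_of_real (1 / s) \<cdot>\<^sub>m x \<in> lipschitz_ball d L n"
    using x self_adjoint_smult_real[OF x, of "1 / s"] by (simp add: lipschitz_ball_def)
  then have "1 / s * f x \<le> c"
    using ball homogeneous[of "1 / s"] s by (metis zero_less_divide_1_iff)
  then have "f x \<le> c * s"
    using s by (simp add: field_simps)
  also have "\<dots> \<le> c * L n x + e"
    using \<delta> by (simp add: s_def distrib_left)
  finally show "f x \<le> c * L n x + e" .
qed

text \<open>Along an orbit the semi-norm shrinks like \<open>l ^ k\<close>. Only this scaled form of
  the cost bound passes that gain on to the displacement.\<close>

lemma cost_cb_homogeneous:
  assumes L: "matrix_lipschitz_seminorm d L" "n \<ge> 1" and "linear_map d \<Psi>"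
    and x: "x \<in> carrier_mat (n * d) (n * d)" "self_adjoint x"
    and cost: "cost_cb d L \<Psi> \<le> ereal c"
  shows "op_norm (amplify d n \<Psi> x - x) \<le> c * L n x"
proof (rule homogeneous_le_seminorm[OF L x, where f = "\<lambda>x. op_norm (amplify d n \<Psi> x - x)"])
  show "op_norm (amplify d n \<Psi> y - y) \<le> c" if "y \<in> lipschitz_ball d L n" for y
    using order_trans[OF cost_cb_upper[OF L(2) that] cost] by simp
  show "op_norm (amplify d n \<Psi> (complex_of_real t \<cdot>\<^sub>m x) - complex_of_real t \<cdot>\<^sub>m x)
      = t * op_norm (amplify d n \<Psi> x - x)" if "0 < t" for t
  proof -
    have "amplify d n \<Psi> (complex_of_real t \<cdot>\<^sub>m x) - complex_of_real t \<cdot>\<^sub>m x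
        = complex_of_real t \<cdot>\<^sub>m (amplify d n \<Psi> x - x)"
      using x by (subst amplify_smult[OF assms(3)])
        (auto intro!: eq_matI simp: right_diff_distrib)
    then show ?thesis
      using that by (simp add: op_norm_smult)
  qed
  show "0 \<le> c"
    using order_trans[OF cost_cb_nonneg[OF L(1)] cost] by simp
qed

lemma lip_cb_homogeneous:
  assumes L: "matrix_lipschitz_seminorm d L" "n \<ge> 1" and "linear_map d \<Psi>"
    and x: "x \<in> carrier_mat (n * d) (n * d)" "self_adjoint x"
    and lip: "lip_cb d L \<Psi> \<le> ereal l"
  shows "L n (amplify d n \<Psi> x) \<le> l * L n x"
proof (rule homogeneous_le_seminorm[OF L x, where f = "\<lambda>x. L n (amplify d n \<Psi> x)"])
  show "L n (amplify d n \<Psi> y) \<le> l" if "y \<in> lipschitz_ball d L n" for y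
    using order_trans[OF lip_cb_upper[OF L(2) that] lip] by simp
  show "L n (amplify d n \<Psi> (complex_of_real t \<cdot>\<^sub>m x)) = t * L n (amplify d n \<Psi> x)" if "0 < t" for t
    using that x by (simp add: amplify_smult[OF assms(3)] lipschitz_seminorm_smult[OF L])
  show "0 \<le> l"
    using order_trans[OF lip_cb_nonneg[OF L(1)] lip] by simp
qed

section \<open>Iterates\<close>

lemma linear_map_funpow:
  assumes "linear_map d \<Psi>"
  shows "linear_map d (\<Psi> ^^ k)"
  using assms by (induction k) (auto simp: linear_map_def)

text \<open>The two claims share one induction, because the Lipschitz bound may be applied to an
  iterate only once that iterate is known to be self-adjoint.\<close>

lemma funpow_seminorm_le:
  assumes L: "matrix_lipschitz_seminorm d L" "n \<ge> 1" and lin: "linear_map d \<Psi>"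
    and star: "\<And>x. x \<in> carrier_mat d d \<Longrightarrow> \<Psi> (mat_adjoint x) = mat_adjoint (\<Psi> x)"
    and x: "x \<in> carrier_mat (n * d) (n * d)" "self_adjoint x"
    and lip: "lip_cb d L \<Psi> \<le> ereal l"
  shows "self_adjoint (amplify d n (\<Psi> ^^ k) x) \<and> L n (amplify d n (\<Psi> ^^ k) x) \<le> l ^ k * L n x"
proof (induction k)
  case 0
  then show ?case
    using x by (simp add: amplify_id[unfolded id_def] id_def)
next
  case (Suc k)
  let ?y = "amplify d n (\<Psi> ^^ k) x"
  have carrier: "(\<Psi> ^^ k) y \<in> carrier_mat d d" if "y \<in> carrier_mat d d" for y k
    using linear_map_funpow[OF lin, of k] that by (simp add: linear_map_def)
  have step: "amplify d n (\<Psi> ^^ Suc k) x = amplify d n \<Psi> ?y"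
    by (subst amplify_comp) (auto intro: carrier)
  have l: "0 \<le> l"
    using order_trans[OF lip_cb_nonneg[OF L(1)] lip] by simp
  have "self_adjoint (amplify d n \<Psi> ?y)"
  proof (rule self_adjoint_amplify)
    show "\<Psi> (mat_adjoint y) = mat_adjoint (\<Psi> y)" if "y \<in> carrier_mat d d" for y
      using that by (rule star)
    show "\<Psi> y \<in> carrier_mat d d" if "y \<in> carrier_mat d d" for y
      using lin that by (simp add: linear_map_def)
  qed (use Suc.IH in simp_all)
  moreover have "L n (amplify d n \<Psi> ?y) \<le> l * L n ?y"
    using Suc.IH by (intro lip_cb_homogeneous[OF L lin amplify_carrier _ lip]) simp
  moreover have "l * L n ?y \<le> l * (l ^ k * L n x)"
    using Suc.IH l by (intro mult_left_mono) simp_all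
  ultimately show ?case
    unfolding step by (simp add: mult.assoc)
qed

lemma funpow_absorb:
  assumes "linear_map d \<Psi>" "\<forall>x\<in>carrier_mat d d. E (\<Psi> x) = E x" "x \<in> carrier_mat d d"
  shows "E ((\<Psi> ^^ k) x) = E x"
proof (induction k)
  case (Suc k)
  have "(\<Psi> ^^ k) x \<in> carrier_mat d d"
    using linear_map_funpow[OF assms(1), of k] assms(3) by (simp add: linear_map_def)
  then show ?case
    using assms(2) Suc by simp
qed simp

lemma amplify_funpow_absorb:
  assumes "linear_map d \<Psi>" "\<forall>x\<in>carrier_mat d d. E (\<Psi> x) = E x"
  shows "amplify d n E (amplify d n (\<Psi> ^^ k) x) = amplify d n E x"
proof -
  have "amplify d n E (amplify d n (\<Psi> ^^ k) x) = amplify d n (E \<circ> (\<Psi> ^^ k)) x"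
    using linear_map_funpow[OF assms(1), of k] by (intro amplify_comp) (simp add: linear_map_def)
  also have "\<dots> = amplify d n E x"
    by (intro amplify_cong) (simp add: funpow_absorb[OF assms])
  finally show ?thesis .
qed

section \<open>Two bounds on the cost of the conditional expectation\<close>

lemma cost_cb_le_geometric:
  assumes L: "matrix_lipschitz_seminorm d L" and lin: "linear_map d \<Psi>"
    and star: "\<And>x. x \<in> carrier_mat d d \<Longrightarrow> \<Psi> (mat_adjoint x) = mat_adjoint (\<Psi> x)"
    and E: "linear_map d E" "\<And>x. x \<in> fixed_points d \<Psi> \<Longrightarrow> E x = x"
    and absorb: "\<forall>x\<in>carrier_mat d d. E (\<Psi> x) = E x"
    and lip: "lip_cb d L \<Psi> \<le> ereal l" "l < 1"
    and cost: "cost_cb d L \<Psi> \<le> ereal c"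
  shows "cost_cb d L E \<le> ereal (c / (1 - l))"
proof (rule cost_cb_leI)
  fix n x assume n: "(1::nat) \<le> n" and "x \<in> lipschitz_ball d L n"
  then have x: "x \<in> carrier_mat (n * d) (n * d)" "self_adjoint x" and "L n x \<le> 1"
    by (auto simp: lipschitz_ball_def)
  have l: "0 \<le> l" and c: "0 \<le> c"
    using order_trans[OF lip_cb_nonneg[OF L] lip(1)] order_trans[OF cost_cb_nonneg[OF L] cost]
    by auto
  define X where "X k = amplify d n (\<Psi> ^^ k) x" for k
  have X: "X k \<in> carrier_mat (n * d) (n * d)" for k
    by (simp add: X_def)
  have X0: "X 0 = x"
    using amplify_id[OF x(1)] by (simp add: X_def id_def)
  have X_Suc: "X (Suc k) = amplify d n \<Psi> (X k)" for k
    using linear_map_funpow[OF lin, of k]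
    by (simp add: X_def amplify_comp linear_map_def)
  have X_sa: "self_adjoint (X k)" and "L n (X k) \<le> l ^ k * L n x" for k
    using funpow_seminorm_le[OF L n lin star x lip(1)] by (auto simp: X_def)
  moreover have "l ^ k * L n x \<le> l ^ k" for k
    using l \<open>L n x \<le> 1\<close> by (simp add: mult_left_le)
  ultimately have X_L: "L n (X k) \<le> l ^ k" for k
    by (meson order_trans)
  \<comment> \<open>The increment is the displacement of \<open>X k\<close> under
    \<open>\<Psi>\<close>, so the cost bound applies at \<open>X k\<close>, whose semi-norm is at
    most \<open>l ^ k\<close>.\<close>
  have "op_norm (X (Suc k) - X k) \<le> c * l ^ k" for k
  proof -
    have "op_norm (X (Suc k) - X k) \<le> c * L n (X k)"
      unfolding X_Suc by (rule cost_cb_homogeneous[OF L n lin X X_sa cost])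
    also have "\<dots> \<le> c * l ^ k"
      using X_L c by (intro mult_left_mono) auto
    finally show ?thesis .
  qed
  from geometric_increments_op_norm_limit[OF X this l lip(2) c]
  obtain Y where Y: "Y \<in> carrier_mat (n * d) (n * d)"
    and lim: "\<And>i j. i < n * d \<Longrightarrow> j < n * d \<Longrightarrow> (\<lambda>k. X k $$ (i, j)) \<longlonglongrightarrow> Y $$ (i, j)"
    and le: "op_norm (X 0 - Y) \<le> c / (1 - l)"
    by blast
  have fixed: "amplify d n \<Psi> Y = Y"
  proof (rule eq_matI)
    fix i j assume "i < dim_row Y" "j < dim_col Y"
    then have ij: "i < n * d" "j < n * d"
      using Y by auto
    have "(\<lambda>k. X (Suc k) $$ (i, j)) \<longlonglongrightarrow> amplify d n \<Psi> Y $$ (i, j)"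
      unfolding X_Suc using lin lim ij by (rule tendsto_amplify)
    moreover have "(\<lambda>k. X (Suc k) $$ (i, j)) \<longlonglongrightarrow> Y $$ (i, j)"
      using lim[OF ij] by (rule LIMSEQ_Suc)
    ultimately show "amplify d n \<Psi> Y $$ (i, j) = Y $$ (i, j)"
      by (rule LIMSEQ_unique)
  qed (use Y in auto)
  \<comment> \<open>The hypothesis on \<open>E\<close> concerns fixed points in M_d, so invariance
    of \<open>Y\<close> under the amplification is read off block by block.\<close>
  have "E (block_at d Y p q) = block_at d Y p q" if "p < n" "q < n" for p q
  proof -
    have "\<Psi> (block_at d Y p q) \<in> carrier_mat d d"
      using lin by (simp add: linear_map_def)
    from block_at_amplify[of p n q \<Psi>, OF that this] have "\<Psi> (block_at d Y p q) = block_at d Y p q"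
      by (simp add: fixed)
    then show ?thesis
      by (intro E(2)) (simp add: fixed_points_def)
  qed
  then have "amplify d n E Y = amplify d n id Y"
    by (intro eq_matI) (auto simp: amplify_index div_mod_block_index)
  then have E_Y: "amplify d n E Y = Y"
    by (simp add: amplify_id[OF Y])
  \<comment> \<open>By absorption the amplified \<open>E\<close> has the same value at every
    \<open>X k\<close>, namely its value at \<open>x\<close>. By continuity this is its value at
    \<open>Y\<close>, which is \<open>Y\<close>.\<close>
  have "amplify d n E x = Y"
  proof (rule eq_matI)
    fix i j assume "i < dim_row Y" "j < dim_col Y"
    then have ij: "i < n * d" "j < n * d"
      using Y by auto
    have "(\<lambda>k. amplify d n E (X k) $$ (i, j)) \<longlonglongrightarrow> amplify d n E Y $$ (i, j)"
      using E(1) lim ij by (rule tendsto_amplify)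
    then have "(\<lambda>k. amplify d n E x $$ (i, j)) \<longlonglongrightarrow> Y $$ (i, j)"
      by (simp add: X_def amplify_funpow_absorb[OF lin absorb] E_Y)
    then show "amplify d n E x $$ (i, j) = Y $$ (i, j)"
      using LIMSEQ_unique tendsto_const by blast
  qed (use Y in auto)
  then show "op_norm (amplify d n E x - x) \<le> c / (1 - l)"
    using le op_norm_minus_commute[OF x(1) Y] by (simp add: X0)
qed

text \<open>The bounds \<open>c\<close> and \<open>b\<close> are real so that the term
  \<open>c * l ^ N\<close> can later be moved across the inequality, which infinite costs would
  forbid.\<close>

lemma cost_cb_le_add_pow:
  assumes L: "matrix_lipschitz_seminorm d L" and lin: "linear_map d \<Psi>"
    and star: "\<And>x. x \<in> carrier_mat d d \<Longrightarrow> \<Psi> (mat_adjoint x) = mat_adjoint (\<Psi> x)"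
    and E: "linear_map d E"
    and absorb: "\<forall>x\<in>carrier_mat d d. E (\<Psi> x) = E x"
    and lip: "lip_cb d L \<Psi> \<le> ereal l"
    and cost: "cost_cb d L E \<le> ereal c" "cost_cb d L (\<Psi> ^^ N) \<le> ereal b"
  shows "cost_cb d L E \<le> ereal (c * l ^ N + b)"
proof (rule cost_cb_leI)
  fix n x assume n: "(1::nat) \<le> n" and ball: "x \<in> lipschitz_ball d L n"
  then have x: "x \<in> carrier_mat (n * d) (n * d)" "self_adjoint x" and "L n x \<le> 1"
    by (auto simp: lipschitz_ball_def)
  have l: "0 \<le> l" and c: "0 \<le> c"
    using order_trans[OF lip_cb_nonneg[OF L] lip] order_trans[OF cost_cb_nonneg[OF L] cost(1)]
    by auto
  let ?y = "amplify d n (\<Psi> ^^ N) x"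
  have y: "self_adjoint ?y" "L n ?y \<le> l ^ N * L n x"
    using funpow_seminorm_le[OF L n lin star x lip] by auto
  moreover have "l ^ N * L n x \<le> l ^ N"
    using l \<open>L n x \<le> 1\<close> by (simp add: mult_left_le)
  ultimately have "L n ?y \<le> l ^ N"
    by (meson order_trans)
  then have "c * L n ?y \<le> c * l ^ N"
    using c by (intro mult_left_mono) auto
  \<comment> \<open>The amplified \<open>E\<close> agrees at \<open>x\<close> and at
    \<open>?y\<close>, so this displacement of \<open>?y\<close> is also the distance from
    \<open>?y\<close> to the image of \<open>x\<close>.\<close>
  moreover have "op_norm (amplify d n E ?y - ?y) \<le> c * L n ?y"
    using y by (intro cost_cb_homogeneous[OF L n E _ _ cost(1)]) auto
  moreover have "op_norm (?y - x) \<le> b"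
    using order_trans[OF cost_cb_upper[OF n ball] cost(2)] by simp
  moreover have "op_norm (amplify d n E x - x) \<le> op_norm (amplify d n E x - ?y) + op_norm (?y - x)"
    using x by (intro op_norm_diff_triangle) auto
  ultimately show "op_norm (amplify d n E x - x) \<le> c * l ^ N + b"
    by (simp add: amplify_funpow_absorb[OF lin absorb])
qed

section \<open>The bound on the mixing time\<close>

lemma power_le_of_ceiling_ln_ratio:
  fixes l \<epsilon> :: real
  assumes "0 \<le> l" "l < 1" "0 < \<epsilon>"
  shows "l ^ nat (max 1 \<lceil>ln (1 / \<epsilon>) / (- ln l)\<rceil>) \<le> \<epsilon>"
proof (cases "l = 0")
  \<comment> \<open>With \<open>ln 0 = 0\<close> and division by 0 the ratio is 0. The maximum with
    1 keeps the exponent positive, which matters because \<open>0 ^ 0 = 1\<close>.\<close>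
  case True
  then show ?thesis
    using assms by (simp add: zero_power less_max_iff_disj)
next
  case False
  define N where "N = nat (max 1 \<lceil>ln (1 / \<epsilon>) / (- ln l)\<rceil>)"
  have ln_l: "ln l < 0"
    using assms False by simp
  have "ln (1 / \<epsilon>) / (- ln l) \<le> real N"
    unfolding N_def by linarith
  then have "real N * ln l \<le> ln \<epsilon>"
    using ln_l assms by (simp add: ln_div field_simps)
  then have "ln (l ^ N) \<le> ln \<epsilon>"
    using False assms by (simp add: ln_realpow)
  then have "l ^ N \<le> \<epsilon>"
    using False assms by simp
  then show ?thesis
    by (simp only: N_def)
qed

lemma mixing_time_leI:
  assumes "1 \<le> n" "ereal (1 - \<epsilon>) * cost_cb d L E \<le> cost_cb d L (\<Psi> ^^ n)" "real n \<le> b"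
  shows "mixing_time d L E \<epsilon> \<Psi> \<le> ereal b"
  unfolding mixing_time_def using assms by (intro INF_lower2[of n]) auto

theorem proposition1p6:
  fixes d :: nat
    and \<Phi> \<Phi>s E :: "complex mat \<Rightarrow> complex mat"
    and L :: "nat \<Rightarrow> complex mat \<Rightarrow> real"
    and \<epsilon> :: real
  assumes "d \<ge> 1"
    and "completely_positive d \<Phi>"
    and "trace_preserving d \<Phi>"
    and "hs_adjoint d \<Phi> \<Phi>s"
    and "conditional_expectation d (fixed_points d \<Phi>s) E"
    and "matrix_lipschitz_seminorm d L"
    and "\<forall>x\<in>carrier_mat d d. \<Phi>s (E x) = E x"
    and "\<forall>x\<in>carrier_mat d d. E (\<Phi>s x) = E x"
    and "lip_cb d L \<Phi>s < 1"
    and "\<epsilon> > 0"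
  shows "mixing_time d L E \<epsilon> \<Phi>s
    \<le> ereal (real_of_int (max 1 \<lceil>ln (1 / \<epsilon>) / (- ln (real_of_ereal (lip_cb d L \<Phi>s)))\<rceil>))"
proof -
  note L = assms(6) and absorb = assms(8)
  have lin: "linear_map d \<Phi>s"
    using assms(2) by (intro hs_adjoint_linear_map[OF assms(4)]) (simp add: completely_positive_def)
  have star: "\<Phi>s (mat_adjoint x) = mat_adjoint (\<Phi>s x)" if "x \<in> carrier_mat d d" for x
    using hs_adjoint_mat_adjoint[OF assms(4,2) that] .
  have E: "linear_map d E" "\<And>x. x \<in> fixed_points d \<Phi>s \<Longrightarrow> E x = x"
    using assms(5) by (auto simp: conditional_expectation_def)
  define l where "l = real_of_ereal (lip_cb d L \<Phi>s)"
  \<comment> \<open>The constant lies between 0 and 1, hence is finite, and the conversion to a real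
    loses nothing.\<close>
  have lip: "lip_cb d L \<Phi>s = ereal l"
    using lip_cb_nonneg[OF L, of \<Phi>s] assms(9) unfolding l_def
    by (cases "lip_cb d L \<Phi>s") auto
  then have l: "0 \<le> l" "l < 1"
    using lip_cb_nonneg[OF L, of \<Phi>s] assms(9) by auto
  define N where "N = nat (max 1 \<lceil>ln (1 / \<epsilon>) / (- ln l)\<rceil>)"
  have N: "1 \<le> N" and N_eq: "real_of_int (max 1 \<lceil>ln (1 / \<epsilon>) / (- ln l)\<rceil>) = real N"
    by (auto simp: N_def)
  have pow: "l ^ N \<le> \<epsilon>"
    unfolding N_def using l assms(10) by (rule power_le_of_ceiling_ln_ratio)
  have cost_nonneg: "0 \<le> cost_cb d L \<Psi>" for \<Psi>
    using L by (rule cost_cb_nonneg)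
  have "mixing_time d L E \<epsilon> \<Phi>s \<le> ereal (real N)"
  proof (cases "\<epsilon> < 1")
    \<comment> \<open>The factor \<open>1 - \<epsilon>\<close> is at most 0, so the threshold is at
      most 0 even if the cost of \<open>E\<close> is infinite, since 0 * \<infinity> = 0. The first
      step already passes it.\<close>
    case False
    then have "ereal (1 - \<epsilon>) * cost_cb d L E \<le> 0"
      using cost_nonneg[of E] by (simp add: ereal_mult_le_0_iff)
    also have "\<dots> \<le> cost_cb d L (\<Phi>s ^^ 1)"
      by (rule cost_nonneg)
    finally show ?thesis
      using N by (intro mixing_time_leI[of 1]) auto
  next
    case \<epsilon>: True
    show ?thesis
    proof (cases "cost_cb d L E = \<infinity>")
      \<comment> \<open>As \<open>1 - \<epsilon>\<close> is positive, the threshold is \<infinity>,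
        and it can be reached only by an infinite cost.\<close>
      case True
      have "cost_cb d L \<Phi>s = \<infinity>"
      proof (rule ccontr)
        assume "cost_cb d L \<Phi>s \<noteq> \<infinity>"
        then obtain c where "cost_cb d L \<Phi>s = ereal c"
          using cost_nonneg[of \<Phi>s] by (cases "cost_cb d L \<Phi>s") auto
        then have "cost_cb d L E \<le> ereal (c / (1 - l))"
          using lip l by (intro cost_cb_le_geometric[OF L lin star E absorb]) auto
        with True show False
          by simp
      qed
      then show ?thesis
        using N by (intro mixing_time_leI[of 1]) auto
    next
      case False
      then obtain c where c: "cost_cb d L E = ereal c" "0 \<le> c"
        using cost_nonneg[of E] by (cases "cost_cb d L E") auto
      have "ereal ((1 - \<epsilon>) * c) \<le> cost_cb d L (\<Phi>s ^^ N)"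
      \<comment> \<open>The iterate may have infinite cost although \<open>E\<close> does not, and
        then the claim is immediate. Only a real value \<open>b\<close> calls for the additive
        comparison.\<close>
      proof (cases "cost_cb d L (\<Phi>s ^^ N)")
        case (real b)
        then have "c \<le> c * l ^ N + b"
          using cost_cb_le_add_pow[OF L lin star E(1) absorb, of l c N b] lip c by simp
        moreover have "c * l ^ N \<le> c * \<epsilon>"
          using pow c by (intro mult_left_mono) auto
        ultimately show ?thesis
          using real by (simp add: algebra_simps)
      qed (use cost_nonneg[of "\<Phi>s ^^ N"] in auto)
      then show ?thesis
        using N c by (intro mixing_time_leI[of N]) auto
    qed
  qed
  then show ?thesis
    unfolding N_eq[symmetric] l_def .
qed

end
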